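(* Let $X$ and $Y$ be sequential specifications. Let $A$ be an algorithm that implements an $SC(Y)$-consistent object when it is executed on an asynchronous system providing an $L(X)$-consistent object. Then $A$ also implements an $SC(Y)$-consistent object when it is executed in an asynchronous system providing an $SC(X)$-consistent object.
   Context: Histories. A history represents an execution of a system of sequential processes. It contains a set of operations (each with its invocation arguments and returned value), partially ordered by the process order, i.e. the sequential order in which each process performs its own operations. Operations also have a begin and an end in real time. Sequential specification. A sequential specification $T$ is a language, i.e. a set of finite and infinite words whose letters are operations. Linear extension. A linear extension of a history $H$ is a total order $\le$ on all the operations of $H$ that contains the process order and such that each operation $e$ has a finite past $\{e' : e' \le e\}$. Sequential consistency. $H \in SC(T)$ if there exists a linear extension $\le$ of $H$ such that the word composed of all the operations of $H$ ordered by $\le$ belongs to $T$. Linearizability. $H \in L(T)$ if there exists a linear extension $\le$ of $H$ such that (1) for any two operations $a$ and $b$, if the end of $a$ precedes the beginning of $b$ in real time, then $a \le b$, and (2) the word formed of all the operations of $H$ ordered by $\le$ belongs to $T$. Implementation. For a consistency criterion $C\in\{SC, L\}$ and a sequential specification $T$, an algorithm implements a $C(T)$-consistent object if all its executions can be modelled by a history that belongs to $C(T)$, that contains all returned operations and only invoked operations (so an operation interrupted by a crash appears either as complete or as if it never took place). System. A system provides a $C(X)$-consistent object if the processes can call operations of the object $X$, and in every execution the history of the operations on $X$ belongs to $C(X)$. An algorithm executed on such a system implements the operations of an upper-layer object $Y$ by local computation and calls to operations on the provided object $X$. The system is asynchronous: each process proceeds at its own speed, which is not upper bounded and is unknown to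 the other processes, and processes have no access to real time (no global clock), so that the behaviour of a process depends only on its own local computation, the operations invoked on it, and the values returned to it by its calls to operations on $X$. *)

theory Defs
  imports Complex_Main "HOL-Library.Extended_Real"
begin

section \<open>Histories and consistency criteria\<close>

datatype 'a word = Finite_Word "'a list" | Infinite_Word "nat \<Rightarrow> 'a"

text \<open>A letter is an operation: its invocation (with arguments) and its returned value.\<close>

type_synonym ('i, 'o) spec = "('i \<times> 'o) word set"

text \<open>
  Operations are identified by elements of \<open>'e\<close>, so that distinct operations may carry the same
  letter.  An operation that never returns ends at time \<open>\<infinity>\<close>.
\<close>

record ('e, 'i, 'o) history =
  ops :: "'e set"
  process_order :: "'e rel"
  letter :: "'e \<Rightarrow> 'i \<times> 'o"
  begin_time :: "'e \<Rightarrow> real"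
  end_time :: "'e \<Rightarrow> ereal"

definition linear_extension :: "('e, 'i, 'o) history \<Rightarrow> 'e rel \<Rightarrow> bool" where
  "linear_extension H le \<longleftrightarrow>
     linear_order_on (ops H) le \<and>
     process_order H \<subseteq> le \<and>
     (\<forall>e\<in>ops H. finite {e'. (e', e) \<in> le})"

text \<open>
  If every element has a finite past, the ordered operations form a finite sequence or a sequence
  of order type \<open>\<omega>\<close>, and the element at position \<open>n\<close> is the one with exactly \<open>n\<close> strict
  predecessors.
\<close>

definition nth_op :: "('e, 'i, 'o) history \<Rightarrow> 'e rel \<Rightarrow> nat \<Rightarrow> 'e" where
  "nth_op H le n = (THE e. e \<in> ops H \<and> card {e'. (e', e) \<in> le \<and> e' \<noteq> e} = n)"

definition word_of :: "('e, 'i, 'o) history \<Rightarrow> 'e rel \<Rightarrow> ('i \<times> 'o) word" where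
  "word_of H le =
     (if finite (ops H)
      then Finite_Word (map (\<lambda>n. letter H (nth_op H le n)) [0..<card (ops H)])
      else Infinite_Word (\<lambda>n. letter H (nth_op H le n)))"

definition SC :: "('i, 'o) spec \<Rightarrow> ('e, 'i, 'o) history set" where
  "SC T = {H. \<exists>le. linear_extension H le \<and> word_of H le \<in> T}"

definition L :: "('i, 'o) spec \<Rightarrow> ('e, 'i, 'o) history set" where
  "L T = {H. \<exists>le. linear_extension H le \<and>
                  (\<forall>a\<in>ops H. \<forall>b\<in>ops H. end_time H a < ereal (begin_time H b) \<longrightarrow> (a, b) \<in> le) \<and>
                  word_of H le \<in> T}"


section \<open>Algorithms\<close>

text \<open>
  A process runs its code for an invoked operation of the upper layer by local computation steps
  and blocking calls to the provided object; the second argument of \<open>Call\<close> gives the local state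
  reached for each value the call may return.  Sets of outcomes allow nondeterministic local
  computation.  Neither function has access to real time or to other processes.
\<close>

datatype ('s, 'xi, 'xo, 'yo) action =
    Local 's
  | Call 'xi "'xo \<Rightarrow> 's"
  | Return 'yo 's

record ('p, 's, 'xi, 'xo, 'yi, 'yo) algorithm =
  initial :: "'p \<Rightarrow> 's set"
  start :: "'p \<Rightarrow> 's \<Rightarrow> 'yi \<Rightarrow> 's set"
  actions :: "'p \<Rightarrow> 's \<Rightarrow> ('s, 'xi, 'xo, 'yo) action set"

datatype ('s, 'xo) config = Idle 's | Busy 's | Waiting "'xo \<Rightarrow> 's"

datatype ('xi, 'xo, 'yi, 'yo) event =
    InvY 'yi | RetY 'yo | InvX 'xi | RetX 'xo | Internal

inductive transition ::
  "('p, 's, 'xi, 'xo, 'yi, 'yo) algorithm \<Rightarrow> 'p \<Rightarrow>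
   ('s, 'xo) config \<Rightarrow> ('xi, 'xo, 'yi, 'yo) event \<Rightarrow> ('s, 'xo) config \<Rightarrow> bool"
  for A p where
  invY: "s' \<in> start A p s y \<Longrightarrow> transition A p (Idle s) (InvY y) (Busy s')"
| internal: "Local s' \<in> actions A p s \<Longrightarrow> transition A p (Busy s) Internal (Busy s')"
| invX: "Call x k \<in> actions A p s \<Longrightarrow> transition A p (Busy s) (InvX x) (Waiting k)"
| retX: "transition A p (Waiting k) (RetX v) (Busy (k v))"
| retY: "Return v s' \<in> actions A p s \<Longrightarrow> transition A p (Busy s) (RetY v) (Idle s')"


section \<open>Executions\<close>

text \<open>
  Each process \<open>p\<close> performs a finite or infinite sequence of \<open>steps E p\<close> timed events; the values
  of \<open>event E p\<close> and \<open>time E p\<close> beyond that length are irrelevant.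
\<close>

record ('p, 'xi, 'xo, 'yi, 'yo) execution =
  steps :: "'p \<Rightarrow> enat"
  event :: "'p \<Rightarrow> nat \<Rightarrow> ('xi, 'xo, 'yi, 'yo) event"
  time :: "'p \<Rightarrow> nat \<Rightarrow> real"

text \<open>
  Asynchrony: the dates of the events of a process are only required to increase, and to diverge
  if there are infinitely many of them.  A process may stop after any finite number of steps,
  which covers crashes as well as calls that never return.
\<close>

definition execution_of ::
  "('p, 's, 'xi, 'xo, 'yi, 'yo) algorithm \<Rightarrow> ('p, 'xi, 'xo, 'yi, 'yo) execution \<Rightarrow> bool" where
  "execution_of A E \<longleftrightarrow>
     (\<forall>p.
        (\<exists>c. (\<exists>s\<in>initial A p. c 0 = Idle s) \<and>
             (\<forall>i. enat i < steps E p \<longrightarrow> transition A p (c i) (event E p i) (c (Suc i)))) \<and>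
        (\<forall>i j. i < j \<longrightarrow> enat j < steps E p \<longrightarrow> time E p i < time E p j) \<and>
        (\<forall>t. finite {i. enat i < steps E p \<and> time E p i \<le> t}))"


section \<open>Histories modelling an execution\<close>

text \<open>
  The two layers are distinguished by partial functions \<open>ivk\<close> and \<open>rsp\<close> that recognise their
  invocation and response events.  An operation is identified by its process and the position of
  its invocation event; as processes are sequential, it is answered by the next response.
\<close>

definition invoked ::
  "(('xi, 'xo, 'yi, 'yo) event \<Rightarrow> 'i option) \<Rightarrow> ('p, 'xi, 'xo, 'yi, 'yo) execution \<Rightarrow>
   ('p \<times> nat) set" where
  "invoked ivk E = {(p, i). enat i < steps E p \<and> ivk (event E p i) \<noteq> None}"

definition returns_at ::
  "(('xi, 'xo, 'yi, 'yo) event \<Rightarrow> 'o option) \<Rightarrow> ('p, 'xi, 'xo, 'yi, 'yo) execution \<Rightarrow>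
   'p \<times> nat \<Rightarrow> nat \<Rightarrow> bool" where
  "returns_at rsp E = (\<lambda>(p, i) j.
     i < j \<and> enat j < steps E p \<and> rsp (event E p j) \<noteq> None \<and>
     (\<forall>k. i < k \<and> k < j \<longrightarrow> rsp (event E p k) = None))"

text \<open>
  All returned and only invoked operations occur.  The letter of an operation that is invoked but
  does not return is, if it occurs, completed with an arbitrary value.
\<close>

definition history_of ::
  "(('xi, 'xo, 'yi, 'yo) event \<Rightarrow> 'i option) \<Rightarrow> (('xi, 'xo, 'yi, 'yo) event \<Rightarrow> 'o option) \<Rightarrow>
   ('p, 'xi, 'xo, 'yi, 'yo) execution \<Rightarrow> ('p \<times> nat, 'i, 'o) history \<Rightarrow> bool" where
  "history_of ivk rsp E H \<longleftrightarrow>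
     {e \<in> invoked ivk E. \<exists>j. returns_at rsp E e j} \<subseteq> ops H \<and>
     ops H \<subseteq> invoked ivk E \<and>
     process_order H = {((p, i), (q, j)). (p, i) \<in> ops H \<and> (q, j) \<in> ops H \<and> p = q \<and> i \<le> j} \<and>
     (\<forall>(p, i)\<in>ops H.
        ivk (event E p i) = Some (fst (letter H (p, i))) \<and>
        begin_time H (p, i) = time E p i \<and>
        (\<forall>j. returns_at rsp E (p, i) j \<longrightarrow>
             rsp (event E p j) = Some (snd (letter H (p, i))) \<and>
             end_time H (p, i) = ereal (time E p j)) \<and>
        ((\<nexists>j. returns_at rsp E (p, i) j) \<longrightarrow> end_time H (p, i) = \<infinity>))"

fun invX_of :: "('xi, 'xo, 'yi, 'yo) event \<Rightarrow> 'xi option" where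
  "invX_of (InvX x) = Some x"
| "invX_of _ = None"

fun retX_of :: "('xi, 'xo, 'yi, 'yo) event \<Rightarrow> 'xo option" where
  "retX_of (RetX v) = Some v"
| "retX_of _ = None"

fun invY_of :: "('xi, 'xo, 'yi, 'yo) event \<Rightarrow> 'yi option" where
  "invY_of (InvY y) = Some y"
| "invY_of _ = None"

fun retY_of :: "('xi, 'xo, 'yi, 'yo) event \<Rightarrow> 'yo option" where
  "retY_of (RetY v) = Some v"
| "retY_of _ = None"

abbreviation X_history ::
  "('p, 'xi, 'xo, 'yi, 'yo) execution \<Rightarrow> ('p \<times> nat, 'xi, 'xo) history \<Rightarrow> bool" where
  "X_history \<equiv> history_of invX_of retX_of"

abbreviation Y_history ::
  "('p, 'xi, 'xo, 'yi, 'yo) execution \<Rightarrow> ('p \<times> nat, 'yi, 'yo) history \<Rightarrow> bool" where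
  "Y_history \<equiv> history_of invY_of retY_of"

text \<open>
  \<open>executions_on A CX\<close>: the executions of \<open>A\<close> on an asynchronous system about whose provided
  object nothing is known except that its histories belong to \<open>CX\<close>.
\<close>

definition executions_on ::
  "('p, 's, 'xi, 'xo, 'yi, 'yo) algorithm \<Rightarrow> ('p \<times> nat, 'xi, 'xo) history set \<Rightarrow>
   ('p, 'xi, 'xo, 'yi, 'yo) execution set" where
  "executions_on A CX = {E. execution_of A E \<and> (\<exists>H. X_history E H \<and> H \<in> CX)}"

definition implements_on ::
  "('p, 's, 'xi, 'xo, 'yi, 'yo) algorithm \<Rightarrow> ('p \<times> nat, 'yi, 'yo) history set \<Rightarrow>
   ('p \<times> nat, 'xi, 'xo) history set \<Rightarrow> bool" where
  "implements_on A CY CX \<longleftrightarrow> (\<forall>E\<in>executions_on A CX. \<exists>H. Y_history E H \<and> H \<in> CY)"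

end

theory Submission imports Defs
begin

text \<open>
  Neither the behaviour of the processes nor membership in \<open>SC\<close> depends on the dates of the events.
  Given an execution whose history on \<open>X\<close> has a linear extension \<open>\<le>\<close>, let the rank of an
  operation be the number of operations strictly below it.  Ranks increase along each process, so
  the events of every process can be dated anew in such a way that each operation on \<open>X\<close> begins
  before and ends after its rank.  If \<open>a\<close> now ends before \<open>b\<close> begins, then \<open>a\<close> has a smaller rank
  than \<open>b\<close>, so that \<open>\<le>\<close> witnesses linearizability.  The redated execution therefore has a
  sequentially consistent history on \<open>Y\<close>, and restoring the original dates keeps it so.
\<close>

section \<open>Dating a sequence of events around prescribed ranks\<close>

text \<open>To be used with \<open>K\<close> the positions where one process invokes
  \<open>X\<close> and \<open>r\<close> the ranks of these operations. A nondecreasing integer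
  sequence \<open>u\<close> with \<open>u k = r k < u (Suc k)\<close> on \<open>K\<close> becomes
  strictly increasing once \<open>1 / real (Suc i)\<close> is subtracted, and the gap of one absorbs
  this loss.\<close>

lemma strict_mono_on_interpolation:
  fixes r :: "nat \<Rightarrow> nat"
  assumes r: "strict_mono_on K r"
  obtains t :: "nat \<Rightarrow> real"
  where "strict_mono t"
    and "\<And>k. k \<in> K \<Longrightarrow> t k \<le> real (r k)"
    and "\<And>k. k \<in> K \<Longrightarrow> real (r k) \<le> t (Suc k)"
    and "\<And>x. finite {i. t i \<le> x}"
proof -
  define nxt where "nxt i = (LEAST k. k \<in> K \<and> i \<le> k)" for i
  \<comment> \<open>Each index takes the rank of the next position in \<open>K\<close>, itself
    included. Past the last such position, the sum dominates all earlier ranks and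
    \<open>Suc i\<close> forces divergence.\<close>
  define u where
    "u i = (if \<exists>k\<in>K. i \<le> k then r (nxt i) else Suc i + (\<Sum>k<i. r k))" for i
  define t where "t i = real (u i) - 1 / real (Suc i)" for i
  have nxt: "nxt i \<in> K \<and> i \<le> nxt i" if "\<exists>k\<in>K. i \<le> k" for i
    unfolding nxt_def by (rule LeastI_ex) (use that in blast)
  have nxt_le: "nxt i \<le> k" if "k \<in> K" "i \<le> k" for i k
    unfolding nxt_def by (rule Least_le) (use that in blast)
  have r_le: "r k \<le> r l" if "k \<in> K" "l \<in> K" "k \<le> l" for k l
    using strict_mono_onD[OF r, of k l] that by (cases "k = l") auto
  have r_sum: "r k \<le> (\<Sum>k<i. r k)" if "k < i" for i k
    using that by (intro member_le_sum) auto
  have u_K: "u k = r k" if "k \<in> K" for k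
  proof -
    have "nxt k = k"
      using nxt[of k] nxt_le[of k k] that by force
    then show ?thesis
      using that by (auto simp: u_def)
  qed
  have u_Suc: "r k < u (Suc k)" if k: "k \<in> K" for k
  proof (cases "\<exists>l\<in>K. Suc k \<le> l")
    case True
    then show ?thesis
      using nxt[OF True] strict_mono_onD[OF r k, of "nxt (Suc k)"] by (simp add: u_def)
  next
    case False
    then show ?thesis
      by (simp add: u_def)
  qed
  have u_mono: "u i \<le> u j" if "i \<le> j" for i j
  proof (cases "\<exists>k\<in>K. j \<le> k")
    case True
    note j = nxt[OF True]
    then have i: "\<exists>k\<in>K. i \<le> k"
      using that le_trans by blast
    show ?thesis
      using r_le[of "nxt i" "nxt j"] nxt[OF i] nxt_le[of "nxt j" i] i j True that
      by (simp add: u_def)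
  next
    case j: False
    show ?thesis
    proof (cases "\<exists>k\<in>K. i \<le> k")
      case True
      then have "nxt i < j"
        using nxt[OF True] j by force
      then show ?thesis
        using r_sum[of "nxt i" j] True j by (simp add: u_def)
    next
      case False
      have "(\<Sum>k<i. r k) \<le> (\<Sum>k<j. r k)"
        using that by (intro sum_mono2) auto
      then show ?thesis
        using False j that by (simp add: u_def)
    qed
  qed
  \<comment> \<open>Such an index is at most \<open>n\<close> or at most some \<open>k\<close> in
    \<open>K\<close> with \<open>r k \<le> n\<close>; as \<open>r\<close> is injective on
    \<open>K\<close>, there are finitely many such \<open>k\<close>.\<close>
  have fin_u: "finite {i. u i \<le> n}" for n
  proof -
    have "inj_on r {k \<in> K. r k \<le> n}"
      using strict_mono_on_imp_inj_on[OF r] by (rule inj_on_subset) auto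
    moreover have "finite (r ` {k \<in> K. r k \<le> n})"
      by (rule finite_subset[of _ "{..n}"]) auto
    ultimately have "finite {k \<in> K. r k \<le> n}"
      by (simp add: finite_image_iff)
    moreover have "{i. u i \<le> n} \<subseteq> {..n} \<union> (\<Union>k\<in>{k \<in> K. r k \<le> n}. {..k})"
    proof
      fix i assume i: "i \<in> {i. u i \<le> n}"
      show "i \<in> {..n} \<union> (\<Union>k\<in>{k \<in> K. r k \<le> n}. {..k})"
      proof (cases "\<exists>k\<in>K. i \<le> k")
        case True
        with i have "r (nxt i) \<le> n"
          by (simp add: u_def)
        then show ?thesis
          using nxt[OF True] by auto
      next
        case False
        then have "u i = Suc i + (\<Sum>k<i. r k)"
          by (simp add: u_def)
        then show ?thesis
          using i by simp
      qed
    qed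
    ultimately show ?thesis
      by (meson finite_UN_I finite_Un finite_atMost finite_subset)
  qed
  show thesis
  proof
    show "strict_mono t"
    proof (rule strict_monoI)
      fix i j :: nat assume "i < j"
      then have "real (u i) \<le> real (u j)" "1 / real (Suc j) < 1 / real (Suc i)"
        using u_mono[of i j] by (auto simp: frac_less2)
      then show "t i < t j"
        by (simp add: t_def)
    qed
    show "t k \<le> real (r k)" if "k \<in> K" for k
      using u_K[OF that] by (simp add: t_def)
    show "real (r k) \<le> t (Suc k)" if "k \<in> K" for k
    proof -
      have "real (r k) + 1 \<le> real (u (Suc k))"
        using u_Suc[OF that] by linarith
      moreover have "1 / real (Suc (Suc k)) \<le> 1"
        by simp
      ultimately show ?thesis
        unfolding t_def by linarith
    qed
    show "finite {i. t i \<le> x}" for x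
    proof (rule finite_subset[OF _ fin_u])
      show "{i. t i \<le> x} \<subseteq> {i. u i \<le> nat \<lceil>x + 1\<rceil>}"
      proof
        fix i assume "i \<in> {i. t i \<le> x}"
        moreover have "1 / real (Suc i) \<le> 1"
          by simp
        ultimately have "real (u i) \<le> x + 1"
          unfolding t_def mem_Collect_eq by linarith
        then show "i \<in> {i. u i \<le> nat \<lceil>x + 1\<rceil>}"
          by (simp, linarith)
      qed
    qed
  qed
qed

section \<open>Changing the dates of a history\<close>

lemma returns_at_unique:
  assumes "returns_at rsp E e j" "returns_at rsp E e k"
  shows "j = k"
  using assms by (cases e; cases j k rule: linorder_cases) (auto simp: returns_at_def)

definition redate ::
  "(('xi, 'xo, 'yi, 'yo) event \<Rightarrow> 'o option) \<Rightarrow> ('p, 'xi, 'xo, 'yi, 'yo) execution \<Rightarrow>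
   ('p \<times> nat, 'i, 'o) history \<Rightarrow> ('p \<times> nat, 'i, 'o) history" where
  "redate rsp E H = H\<lparr>
     begin_time := (\<lambda>(p, i). time E p i),
     end_time := (\<lambda>(p, i). if \<exists>j. returns_at rsp E (p, i) j
                           then ereal (time E p (THE j. returns_at rsp E (p, i) j)) else \<infinity>)\<rparr>"

lemma redate_simps [simp]:
  "ops (redate rsp E H) = ops H"
  "process_order (redate rsp E H) = process_order H"
  "letter (redate rsp E H) = letter H"
  "begin_time (redate rsp E H) (p, i) = time E p i"
  by (simp_all add: redate_def)

lemma end_time_redate:
  "returns_at rsp E (p, i) j \<Longrightarrow> end_time (redate rsp E H) (p, i) = ereal (time E p j)"
  "\<nexists>j. returns_at rsp E (p, i) j \<Longrightarrow> end_time (redate rsp E H) (p, i) = \<infinity>"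
  using returns_at_unique[of rsp E "(p, i)"] by (auto simp: redate_def the_equality)

lemma linear_extension_redate [simp]:
  "linear_extension (redate rsp E H) le \<longleftrightarrow> linear_extension H le"
  by (simp add: linear_extension_def)

lemma word_of_redate [simp]: "word_of (redate rsp E H) le = word_of H le"
  by (simp add: word_of_def nth_op_def)

lemma redate_in_SC [simp]: "redate rsp E H \<in> SC T \<longleftrightarrow> H \<in> SC T"
  by (simp add: SC_def)

text \<open>Matching responses to invocations involves only \<open>steps\<close> and
  \<open>event\<close>. This serves both to carry the history on \<open>X\<close> to new dates and
  to bring the history on \<open>Y\<close> back to the old ones.\<close>

lemma history_of_redate:
  assumes H: "history_of ivk rsp E H"
    and E': "steps E' = steps E" "event E' = event E"
  shows "history_of ivk rsp E' (redate rsp E' H)"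
proof -
  have "returns_at rsp E' = returns_at rsp E" "invoked ivk E' = invoked ivk E"
    by (simp_all add: returns_at_def invoked_def E')
  with H show ?thesis
    by (auto simp: history_of_def E' end_time_redate)
qed

section \<open>Ranks in a linear extension\<close>

text \<open>The position in the word, counted as in \<open>nth_op\<close>; it acts as a clock common
  to all processes.\<close>

definition rank :: "'e rel \<Rightarrow> 'e \<Rightarrow> nat" where
  "rank le e = card {e'. (e', e) \<in> le \<and> e' \<noteq> e}"

text \<open>The strict past of \<open>a\<close> is a proper subset of that of \<open>b\<close>,
  which is finite.\<close>

lemma rank_less:
  assumes le: "linear_extension H le" and ab: "(a, b) \<in> le" "a \<noteq> b"
  shows "rank le a < rank le b"
proof -
  have lin: "trans le" "antisym le" and "b \<in> ops H"
    using le ab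
    by (auto simp: linear_extension_def linear_order_on_def partial_order_on_def preorder_on_def
        refl_on_def)
  then have "finite {e. (e, b) \<in> le}"
    using le by (auto simp: linear_extension_def)
  then show ?thesis
    unfolding rank_def using lin ab
    by (intro psubset_card_mono) (auto dest: transD antisymD)
qed

lemma rank_le_imp_in_linear_extension:
  assumes le: "linear_extension H le" and ab: "a \<in> ops H" "b \<in> ops H"
    and "rank le a \<le> rank le b"
  shows "(a, b) \<in> le"
proof (cases "a = b")
  case True
  then show ?thesis
    using le ab
    by (auto simp: linear_extension_def linear_order_on_def partial_order_on_def preorder_on_def
        refl_on_def)
next
  case False
  then have "(a, b) \<in> le \<or> (b, a) \<in> le"
    using le ab by (auto simp: linear_extension_def linear_order_on_def total_on_def)
  then show ?thesis
    using rank_less[OF le, of b a] False assms(4) by auto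
qed

text \<open>Since \<open>le\<close> contains the process order, the interpolation applies to each
  process separately.\<close>

lemma strict_mono_on_rank:
  assumes "history_of ivk rsp E H" and le: "linear_extension H le"
  shows "strict_mono_on {i. (p, i) \<in> ops H} (\<lambda>i. rank le (p, i))"
proof (rule strict_mono_onI)
  fix i j :: nat
  assume "i \<in> {i. (p, i) \<in> ops H}" "j \<in> {i. (p, i) \<in> ops H}" "i < j"
  then have "((p, i), (p, j)) \<in> process_order H"
    using assms(1) by (auto simp: history_of_def)
  then show "rank le (p, i) < rank le (p, j)"
    using le \<open>i < j\<close> by (intro rank_less[OF le]) (auto simp: linear_extension_def)
qed

text \<open>If \<open>a\<close> ends before \<open>b\<close> begins, the rank of \<open>a\<close> is
  at most the end of \<open>a\<close>, hence at most the beginning of \<open>b\<close>, hence at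
  most the rank of \<open>b\<close>.\<close>

lemma redate_in_L:
  assumes le: "linear_extension H le" and word: "word_of H le \<in> T"
    and mono: "\<And>p. strict_mono (time E p)"
    and begin_le: "\<And>p i. (p, i) \<in> ops H \<Longrightarrow> time E p i \<le> real (rank le (p, i))"
    and le_end: "\<And>p i. (p, i) \<in> ops H \<Longrightarrow> real (rank le (p, i)) \<le> time E p (Suc i)"
  shows "redate rsp E H \<in> L T"
proof -
  let ?H = "redate rsp E H"
  have "(a, b) \<in> le"
    if a: "a \<in> ops H" and b: "b \<in> ops H" and lt: "end_time ?H a < ereal (begin_time ?H b)" for a b
  proof -
    obtain p i q j where eqs: "a = (p, i)" "b = (q, j)"
      by (metis surj_pair)
    \<comment> \<open>A pending operation ends at \<open>\<infinity>\<close> and so precedes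
      nothing.\<close>
    obtain k where k: "returns_at rsp E (p, i) k"
      using end_time_redate(2)[of rsp E p i H] lt eqs by fastforce
    then have "Suc i \<le> k"
      by (simp add: returns_at_def)
    then have "time E p (Suc i) \<le> time E p k"
      using mono by (simp add: strict_mono_less_eq)
    moreover have "time E p k < time E q j"
      using lt end_time_redate(1)[OF k, of H] eqs by simp
    ultimately have "rank le a \<le> rank le b"
      using le_end[of p i] begin_le[of q j] a b eqs by simp
    then show ?thesis
      using rank_le_imp_in_linear_extension[OF le a b] by blast
  qed
  then show ?thesis
    using le word unfolding L_def by auto
qed

theorem proposition1:
  fixes X :: "('xi, 'xo) spec"
    and Y :: "('yi, 'yo) spec"
    and A :: "('p, 's, 'xi, 'xo, 'yi, 'yo) algorithm"
  assumes "implements_on A (SC Y) (L X)"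
  shows "implements_on A (SC Y) (SC X)"
  unfolding implements_on_def
proof
  fix E assume "E \<in> executions_on A (SC X)"
  then obtain H le where E: "execution_of A E" and H: "X_history E H"
    and le: "linear_extension H le" and word: "word_of H le \<in> X"
    by (auto simp: executions_on_def SC_def)
  have "\<forall>p. \<exists>t :: nat \<Rightarrow> real. strict_mono t \<and>
      (\<forall>i. (p, i) \<in> ops H \<longrightarrow> t i \<le> real (rank le (p, i)) \<and> real (rank le (p, i)) \<le> t (Suc i)) \<and>
      (\<forall>x. finite {i. t i \<le> x})"
  proof
    fix p
    show "\<exists>t :: nat \<Rightarrow> real. strict_mono t \<and>
      (\<forall>i. (p, i) \<in> ops H \<longrightarrow> t i \<le> real (rank le (p, i)) \<and> real (rank le (p, i)) \<le> t (Suc i)) \<and>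
      (\<forall>x. finite {i. t i \<le> x})"
      by (rule strict_mono_on_interpolation[OF strict_mono_on_rank[OF H le, of p]]) blast
  qed
  then obtain t :: "'p \<Rightarrow> nat \<Rightarrow> real" where mono: "\<And>p. strict_mono (t p)"
    and rank: "\<And>p i. (p, i) \<in> ops H \<Longrightarrow>
      t p i \<le> real (rank le (p, i)) \<and> real (rank le (p, i)) \<le> t p (Suc i)"
    and fin: "\<And>p x. finite {i. t p i \<le> x}"
    by metis
  define E' where "E' = E\<lparr>time := t\<rparr>"
  have E': "steps E' = steps E" "event E' = event E" "time E' = t"
    by (simp_all add: E'_def)
  have "finite {i. enat i < steps E p \<and> t p i \<le> x}" for p x
    by (rule finite_subset[OF _ fin[of p x]]) auto
  then have "execution_of A E'"
    using E mono by (simp add: execution_of_def E' strict_mono_less)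
  moreover have "X_history E' (redate retX_of E' H)"
    by (rule history_of_redate[OF H]) (simp_all add: E')
  moreover have "redate retX_of E' H \<in> L X"
    using le word mono rank by (intro redate_in_L) (auto simp: E')
  ultimately have "E' \<in> executions_on A (L X)"
    unfolding executions_on_def by blast
  then obtain HY where HY: "Y_history E' HY" "HY \<in> SC Y"
    using assms unfolding implements_on_def by blast
  \<comment> \<open>Here \<open>E'\<close> is the source and \<open>E\<close> the target: they
    differ only in \<open>time\<close>.\<close>
  have "Y_history E (redate retY_of E HY)"
    by (rule history_of_redate[OF HY(1)]) (simp_all add: E')
  then show "\<exists>H. Y_history E H \<and> H \<in> SC Y"
    using HY(2) redate_in_SC by blast
qed

end
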